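(* Let $\ell\ge m\ge n>0$ and let $\mathcal{A}=\sum_{i=1}^r\alpha_i\otimes\beta_i\otimes\gamma_i\in\mathbb{C}^{\ell+1}\otimes\mathbb{C}^{m+1}\otimes\mathbb{C}^{n+1}$ be a tensor of rank $r\le\min\{\ell+1,mn\}$ that is generic in the sense of the context. Let $I=\langle\ker\mathcal{A}_{(1)}\rangle\subset S$ and $\zeta_i=(\beta_i,\gamma_i)\in X=\mathbb{P}^m\times\mathbb{P}^n$. Let $(d,e)\in\mathbb{N}^2$ with $(d,e)\ge(1,1)$ and $\mathrm{HF}_{S/I}(d,e)=r$, put $(d',e')=(d-1,e-1)$, and let $h_0\in S_{(d',e')}$ satisfy $h_0(\zeta_i)\ne0$ for $i=1,\dots,r$. Let $N:S_{(d,e)}\to\mathbb{C}^r$ be a pre-normal form, i.e., a $\mathbb{C}$-linear map with $\operatorname{rank}(N)=r$ and $\ker N=I_{(d,e)}$. For $g\in S_{(d',e')}$ let $N_g:S_{(1,1)}\to\mathbb{C}^r$, $N_g(f)=N(gf)$. Let $B\subset S_{(1,1)}$ be any $r$-dimensional subspace such that the restriction $(N_{h_0})_{|B}:B\to\mathbb{C}^r$ is invertible. Then for any $g\in S_{(d',e')}$, $$w_i^\top\circ M_{g/h_0}=\frac{g}{h_0}(\zeta_i)\cdot w_i^\top,\qquad i=1,\dots,r,$$ where $M_{g/h_0}=(N_{h_0})_{|B}^{-1}\circ(N_g)_{|B}:B\to B$ and $w_i^\top\in B^\vee$ is given by $w_i^\top(b)=b(\beta_i,\gamma_i)$ for $b\in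 B$.
   Context: $S=\mathbb{C}[x_0,\dots,x_m,y_0,\dots,y_n]=\bigoplus_{(d,e)\in\mathbb{N}^2}S_{(d,e)}$, with $S_{(d,e)}$ spanned by monomials of degree $d$ in $x$ and $e$ in $y$; $\mathbb{N}\ni 0$, and tuples are compared entrywise. For a homogeneous ideal $I$: $I_{(d,e)}=I\cap S_{(d,e)}$, $\mathrm{HF}_{S/I}(d,e)=\dim_{\mathbb{C}}S_{(d,e)}/I_{(d,e)}$, $V_X(I)\subset X=\mathbb{P}^m\times\mathbb{P}^n$ its zero set. The flattening $\mathcal{A}_{(1)}=\sum_i\alpha_i(\beta_i\otimes\gamma_i)^\top$ is viewed as a linear map $S_{(1,1)}\to\mathbb{C}^{\ell+1}$ by identifying $e_k\otimes e_l$ with $x_ky_l$, so $\mathcal{A}_{(1)}(f)=\sum_i f(\beta_i,\gamma_i)\alpha_i$. Generic means: (i) $\mathcal{A}$ is $r$-identifiable (there is exactly one set of $r$ rank-1 tensors with sum $\mathcal{A}$); (ii) $\mathcal{A}_{(1)}$ has rank $r$; (iii) $V_X(I)=\{\zeta_1,\dots,\zeta_r\}$ for $I=\langle\ker\mathcal{A}_{(1)}\rangle$, and these are $r$ points of multiplicity one (the subscheme of $X$ defined by $I$ is reduced at each of them). *)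

theory Defs
  imports "HOL-Analysis.Analysis" "HOL-Library.Poly_Mapping"
begin

text \<open>
  A polynomial is a finitely supported map from monomials to coefficients, and a monomial is a
  finitely supported map from variables to exponents. The variables \<open>x\<^sub>0, \<dots>, x\<^sub>m\<close> are \<open>Inl k\<close> for
  \<open>k :: 'm\<close>, and \<open>y\<^sub>0, \<dots>, y\<^sub>n\<close> are \<open>Inr k\<close> for \<open>k :: 'n\<close>; thus \<open>CARD('m)\<close> is \<open>m + 1\<close> and
  \<open>CARD('n)\<close> is \<open>n + 1\<close>.
\<close>

type_synonym ('m, 'n) monomial = "('m + 'n) \<Rightarrow>\<^sub>0 nat"
type_synonym ('m, 'n) bipoly = "('m, 'n) monomial \<Rightarrow>\<^sub>0 complex"

definition pscale :: "complex \<Rightarrow> ('m, 'n) bipoly \<Rightarrow> ('m, 'n) bipoly" where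
  "pscale c f = Poly_Mapping.single 0 c * f"

interpretation bip: vector_space "pscale :: complex \<Rightarrow> ('m, 'n) bipoly \<Rightarrow> ('m, 'n) bipoly"
  by unfold_locales
    (simp_all add: pscale_def distrib_left distrib_right single_add mult_single
      flip: mult.assoc)

definition xdeg :: "('m::finite, 'n::finite) monomial \<Rightarrow> nat" where
  "xdeg t = (\<Sum>k\<in>UNIV. Poly_Mapping.lookup t (Inl k))"

definition ydeg :: "('m::finite, 'n::finite) monomial \<Rightarrow> nat" where
  "ydeg t = (\<Sum>k\<in>UNIV. Poly_Mapping.lookup t (Inr k))"

definition bideg :: "nat \<Rightarrow> nat \<Rightarrow> ('m::finite, 'n::finite) bipoly set" where
  "bideg d e = bip.span {Poly_Mapping.single t 1 | t. xdeg t = d \<and> ydeg t = e}"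

definition evalp ::
  "('m::finite, 'n::finite) bipoly \<Rightarrow> complex ^ 'm \<Rightarrow> complex ^ 'n \<Rightarrow> complex" where
  "evalp f u v = (\<Sum>t\<in>Poly_Mapping.keys f. Poly_Mapping.lookup f t *
     (\<Prod>k\<in>UNIV. u $ k ^ Poly_Mapping.lookup t (Inl k)) *
     (\<Prod>k\<in>UNIV. v $ k ^ Poly_Mapping.lookup t (Inr k)))"

text \<open>An ideal is a submodule of the ring over itself.\<close>

definition ideal_gen :: "('m, 'n) bipoly set \<Rightarrow> ('m, 'n) bipoly set" where
  "ideal_gen G = module.span (*) G"

text \<open>The residue classes of the elements of \<open>E\<close> are distinct and form a basis of \<open>V / W\<close>.\<close>

definition quot_basis ::
  "('m, 'n) bipoly set \<Rightarrow> ('m, 'n) bipoly set \<Rightarrow> ('m, 'n) bipoly set \<Rightarrow> bool" where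
  "quot_basis V W E \<longleftrightarrow> E \<subseteq> V \<and>
     (\<forall>F c. finite F \<and> F \<subseteq> E \<and> (\<Sum>f\<in>F. pscale (c f) f) \<in> W \<longrightarrow> (\<forall>f\<in>F. c f = 0)) \<and>
     (\<forall>v\<in>V. \<exists>F c. finite F \<and> F \<subseteq> E \<and> v - (\<Sum>f\<in>F. pscale (c f) f) \<in> W)"

definition quot_dim :: "('m, 'n) bipoly set \<Rightarrow> ('m, 'n) bipoly set \<Rightarrow> nat" where
  "quot_dim V W = card (SOME E. quot_basis V W E)"

definition HF :: "('m::finite, 'n::finite) bipoly set \<Rightarrow> nat \<Rightarrow> nat \<Rightarrow> nat" where
  "HF I d e = quot_dim (bideg d e) (I \<inter> bideg d e)"

text \<open>A point of a projective space is the line spanned by a nonzero vector.\<close>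

definition point ::
  "complex ^ 'm \<Rightarrow> complex ^ 'n \<Rightarrow> (complex ^ 'm) set \<times> (complex ^ 'n) set" where
  "point u v = (vec.span {u}, vec.span {v})"

text \<open>
  For a bihomogeneous ideal \<open>I\<close> the vanishing condition does not depend on the representatives
  \<open>u\<close> and \<open>v\<close>.
\<close>

definition VX ::
  "('m::finite, 'n::finite) bipoly set \<Rightarrow> ((complex ^ 'm) set \<times> (complex ^ 'n) set) set" where
  "VX I = {point u v | u v. u \<noteq> 0 \<and> v \<noteq> 0 \<and> (\<forall>f\<in>I. evalp f u v = 0)}"

text \<open>
  The local ring at \<open>\<zeta> = point u v\<close> of the subscheme defined by \<open>I\<close> is the part of bidegree \<open>(0, 0)\<close>
  of the localisation of \<open>S / I\<close> at the bihomogeneous elements that do not vanish at \<open>\<zeta>\<close>. Its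
  elements are the fractions \<open>f / h\<close> below, represented by pairs, and \<open>same_germ\<close> is equality of
  two such fractions. The subscheme is reduced at \<open>\<zeta>\<close> if this ring has no nonzero nilpotents.
\<close>

definition local_fractions ::
  "complex ^ 'm \<Rightarrow> complex ^ 'n \<Rightarrow> (('m::finite, 'n::finite) bipoly \<times> ('m, 'n) bipoly) set" where
  "local_fractions u v =
     {(f, h). \<exists>d e. f \<in> bideg d e \<and> h \<in> bideg d e \<and> evalp h u v \<noteq> 0}"

definition same_germ ::
  "('m::finite, 'n::finite) bipoly set \<Rightarrow> complex ^ 'm \<Rightarrow> complex ^ 'n \<Rightarrow>
   ('m, 'n) bipoly \<times> ('m, 'n) bipoly \<Rightarrow> ('m, 'n) bipoly \<times> ('m, 'n) bipoly \<Rightarrow> bool" where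
  "same_germ I u v p q \<longleftrightarrow>
     (\<exists>d e. \<exists>t\<in>bideg d e. evalp t u v \<noteq> 0 \<and> t * (fst p * snd q - fst q * snd p) \<in> I)"

definition reduced_at ::
  "('m::finite, 'n::finite) bipoly set \<Rightarrow> complex ^ 'm \<Rightarrow> complex ^ 'n \<Rightarrow> bool" where
  "reduced_at I u v \<longleftrightarrow>
     (\<forall>(f, h)\<in>local_fractions u v. \<forall>k::nat.
        same_germ I u v (f ^ k, h ^ k) (0, 1) \<longrightarrow> same_germ I u v (f, h) (0, 1))"

type_synonym ('l, 'm, 'n) tensor = "complex ^ 'n ^ 'm ^ 'l"

definition tensor_prod ::
  "complex ^ 'l \<Rightarrow> complex ^ 'm \<Rightarrow> complex ^ 'n \<Rightarrow> ('l, 'm, 'n) tensor" where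
  "tensor_prod a b c = (\<chi> i j k. a $ i * b $ j * c $ k)"

definition tensor_rank :: "('l::finite, 'm::finite, 'n::finite) tensor \<Rightarrow> nat" where
  "tensor_rank A = (LEAST s. \<exists>a b c. A = (\<Sum>i<s. tensor_prod (a i) (b i) (c i)))"

definition identifiable :: "nat \<Rightarrow> ('l::finite, 'm::finite, 'n::finite) tensor \<Rightarrow> bool" where
  "identifiable r A \<longleftrightarrow>
     (\<exists>!T. finite T \<and> card T = r \<and> (\<forall>t\<in>T. tensor_rank t = 1) \<and> \<Sum>T = A)"

text \<open>
  The first flattening as a linear map on \<open>bideg 1 1\<close>: the column of the flattening with index
  \<open>(j, k)\<close> is the image of the monomial \<open>x\<^sub>j y\<^sub>k\<close>.
\<close>

definition flattening ::
  "('l, 'm::finite, 'n::finite) tensor \<Rightarrow> ('m, 'n) bipoly \<Rightarrow> complex ^ 'l" where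
  "flattening A f = (\<chi> i. \<Sum>j\<in>UNIV. \<Sum>k\<in>UNIV. A $ i $ j $ k *
     Poly_Mapping.lookup f (Poly_Mapping.single (Inl j) 1 + Poly_Mapping.single (Inr k) 1))"

definition flattening_ideal ::
  "('l::finite, 'm::finite, 'n::finite) tensor \<Rightarrow> ('m, 'n) bipoly set" where
  "flattening_ideal A = ideal_gen {f \<in> bideg 1 1. flattening A f = 0}"

definition generic_decomposition ::
  "('r::finite \<Rightarrow> complex ^ 'l) \<Rightarrow> ('r \<Rightarrow> complex ^ 'm) \<Rightarrow> ('r \<Rightarrow> complex ^ 'n) \<Rightarrow> bool" where
  "generic_decomposition \<alpha> \<beta> \<gamma> \<longleftrightarrow>
     (let A = \<Sum>i\<in>UNIV. tensor_prod (\<alpha> i) (\<beta> i) (\<gamma> i);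
          I = flattening_ideal A;
          \<zeta> = \<lambda>i. point (\<beta> i) (\<gamma> i)
      in identifiable CARD('r) A \<and>
         vec.dim (flattening A ` (bideg 1 1 :: ('m, 'n) bipoly set)) = CARD('r) \<and>
         VX I = range \<zeta> \<and> inj \<zeta> \<and> (\<forall>i. reduced_at I (\<beta> i) (\<gamma> i)))"

definition linear_on ::
  "('m, 'n) bipoly set \<Rightarrow> (('m, 'n) bipoly \<Rightarrow> complex ^ 'r) \<Rightarrow> bool" where
  "linear_on V N \<longleftrightarrow> (\<forall>f\<in>V. \<forall>g\<in>V. N (f + g) = N f + N g) \<and>
     (\<forall>c. \<forall>f\<in>V. N (pscale c f) = c *s N f)"

text \<open>Only the values of \<open>N\<close> on \<open>bideg d e\<close> matter.\<close>

definition pre_normal_form :: "('m::finite, 'n::finite) bipoly set \<Rightarrow> nat \<Rightarrow> nat \<Rightarrow>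
    (('m, 'n) bipoly \<Rightarrow> complex ^ 'r) \<Rightarrow> bool" where
  "pre_normal_form I d e N \<longleftrightarrow> linear_on (bideg d e) N \<and>
     vec.dim (N ` bideg d e) = CARD('r) \<and>
     {f \<in> bideg d e. N f = 0} = I \<inter> bideg d e"

definition premult ::
  "(('m, 'n) bipoly \<Rightarrow> complex ^ 'r) \<Rightarrow> ('m, 'n) bipoly \<Rightarrow> ('m, 'n) bipoly \<Rightarrow> complex ^ 'r" where
  "premult N g f = N (g * f)"

text \<open>
  As a map \<open>B \<rightarrow> B\<close> this is meaningful only when \<open>premult N h\<close> is bijective from \<open>B\<close> to the whole
  codomain.
\<close>

definition mult_map ::
  "(('m, 'n) bipoly \<Rightarrow> complex ^ 'r) \<Rightarrow> ('m, 'n) bipoly set \<Rightarrow> ('m, 'n) bipoly \<Rightarrow>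
   ('m, 'n) bipoly \<Rightarrow> ('m, 'n) bipoly \<Rightarrow> ('m, 'n) bipoly" where
  "mult_map N B g h = inv_into B (premult N h) \<circ> premult N g"

end

theory Submission
  imports Defs
begin

text \<open>
  If \<open>b' = M\<^bsub>g/h\<^sub>0\<^esub> b\<close>, then \<open>N (g b) = N (h\<^sub>0 b')\<close>, so \<open>g b - h\<^sub>0 b'\<close> lies in \<open>ker N\<close>, which is
  contained in \<open>I\<close>. Since \<open>\<zeta>\<^sub>i \<in> V\<^sub>X(I)\<close>, evaluating at \<open>(\<beta>\<^sub>i, \<gamma>\<^sub>i)\<close> gives
  \<open>g(\<zeta>\<^sub>i) b(\<zeta>\<^sub>i) = h\<^sub>0(\<zeta>\<^sub>i) b'(\<zeta>\<^sub>i)\<close>.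
\<close>

definition eval_monomial ::
  "complex ^ 'm \<Rightarrow> complex ^ 'n \<Rightarrow> ('m::finite, 'n::finite) monomial \<Rightarrow> complex" where
  "eval_monomial u v t = (\<Prod>k\<in>UNIV. u $ k ^ Poly_Mapping.lookup t (Inl k)) *
     (\<Prod>k\<in>UNIV. v $ k ^ Poly_Mapping.lookup t (Inr k))"

lemma eval_monomial_add:
  "eval_monomial u v (s + t) = eval_monomial u v s * eval_monomial u v t"
  by (simp add: eval_monomial_def lookup_add power_add prod.distrib)

lemma eval_monomial_scale:
  "eval_monomial (a *s u) (b *s v) t = a ^ xdeg t * b ^ ydeg t * eval_monomial u v t"
  by (simp add: eval_monomial_def xdeg_def ydeg_def power_mult_distrib prod.distrib power_sum)

text \<open>Terms outside the support contribute zero. The freedom in \<open>T\<close> matters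
  because cancellation can make the support of a sum smaller than the union of the supports, so that
  sums of polynomials need a common index set.\<close>

lemma evalp_eq_sum:
  assumes "finite T" "Poly_Mapping.keys f \<subseteq> T"
  shows "evalp f u v = (\<Sum>t\<in>T. Poly_Mapping.lookup f t * eval_monomial u v t)"
  unfolding evalp_def eval_monomial_def mult.assoc
  by (rule sum.mono_neutral_left) (use assms in \<open>auto simp: in_keys_iff\<close>)

lemma evalp_single: "evalp (Poly_Mapping.single t c) u v = c * eval_monomial u v t"
  by (subst evalp_eq_sum[of "{t}"]) auto

lemma evalp_add: "evalp (f + g) u v = evalp f u v + evalp g u v"
proof -
  let ?T = "Poly_Mapping.keys f \<union> Poly_Mapping.keys g"
  have "Poly_Mapping.keys (f + g) \<subseteq> ?T"
    by (rule keys_add)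
  then show ?thesis
    by (simp add: evalp_eq_sum[of ?T] lookup_add distrib_right sum.distrib)
qed

lemma evalp_zero [simp]: "evalp 0 u v = 0"
  by (simp add: evalp_def)

lemma evalp_diff: "evalp (f - g) u v = evalp f u v - evalp g u v"
  using evalp_add[of "f - g" g u v] by simp

text \<open>Updating at a key outside the support is the same as adding a single term. Phrasing the
  step with \<open>+\<close> lets additivity and distributivity apply directly.\<close>

lemma poly_mapping_add_induct [case_names zero add]:
  fixes f :: "'a \<Rightarrow>\<^sub>0 'b::comm_monoid_add"
  assumes "P 0"
    and "\<And>t c f. P f \<Longrightarrow> P (Poly_Mapping.single t c + f)"
  shows "P f"
proof (induction f rule: Poly_Mapping.update_induct)
  case const
  show ?case by (fact assms(1))
next
  case (update f t c)
  have "Poly_Mapping.update t c f = Poly_Mapping.single t c + f"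
    using update.hyps(1)
    by (intro poly_mapping_eqI) (auto simp: lookup_update lookup_add lookup_single in_keys_iff)
  with assms(2)[OF update.IH] show ?case by simp
qed

text \<open>Both sides are additive in \<open>f\<close> and in \<open>g\<close>, so two nested
  inductions reduce the claim to single terms, where exponents add and
  \<open>eval_monomial_add\<close> applies.\<close>

lemma evalp_mult: "evalp (f * g) u v = evalp f u v * evalp g u v"
proof (induction f rule: poly_mapping_add_induct)
  case zero
  show ?case by simp
next
  case (add s a f)
  have "evalp (Poly_Mapping.single s a * g) u v = evalp (Poly_Mapping.single s a) u v * evalp g u v"
    by (induction g rule: poly_mapping_add_induct)
      (simp_all add: distrib_left evalp_add mult_single evalp_single eval_monomial_add)
  with add show ?case
    by (simp add: distrib_right evalp_add)
qed

text \<open>This is span induction with the scalar absorbed into the coefficient of the monomial, so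
  each step adds one term of bidegree \<open>(d, e)\<close>.\<close>

lemma bideg_induct [consumes 1, case_names zero add]:
  assumes "f \<in> bideg d e"
    and "P 0"
    and "\<And>c t f. xdeg t = d \<Longrightarrow> ydeg t = e \<Longrightarrow> P f \<Longrightarrow> P (Poly_Mapping.single t c + f)"
  shows "P f"
  using assms(1) unfolding bideg_def
proof (induction rule: bip.span_induct_alt)
  case base
  then show ?case by (fact assms(2))
next
  case (step c x y)
  then show ?case
    using assms(3)[of _ y c] by (auto simp: pscale_def mult_single)
qed

text \<open>Every term of \<open>f\<close> picks up the same factor, which therefore comes out of
  the sum. This makes vanishing at a point independent of the representatives.\<close>

lemma evalp_scale:
  assumes "f \<in> bideg d e"
  shows "evalp f (a *s u) (b *s v) = a ^ d * b ^ e * evalp f u v"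
  using assms
proof (induction rule: bideg_induct)
  case zero
  show ?case by simp
next
  case (add c t f)
  then show ?case
    by (simp add: evalp_add evalp_single eval_monomial_scale algebra_simps)
qed

lemma subspace_bideg: "bip.subspace (bideg d e)"
  unfolding bideg_def by (rule bip.subspace_span)

lemma single_in_bideg: "Poly_Mapping.single t c \<in> bideg (xdeg t) (ydeg t)"
proof -
  have "Poly_Mapping.single t 1 \<in> bideg (xdeg t) (ydeg t)"
    unfolding bideg_def by (rule bip.span_base) blast
  then have "pscale c (Poly_Mapping.single t 1) \<in> bideg (xdeg t) (ydeg t)"
    by (rule bip.subspace_scale[OF subspace_bideg])
  then show ?thesis
    by (simp add: pscale_def mult_single)
qed

lemma xdeg_add: "xdeg (s + t) = xdeg s + xdeg t"
  by (simp add: xdeg_def lookup_add sum.distrib)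

lemma ydeg_add: "ydeg (s + t) = ydeg s + ydeg t"
  by (simp add: ydeg_def lookup_add sum.distrib)

lemma bideg_mult:
  assumes "f \<in> bideg d e" "g \<in> bideg d' e'"
  shows "f * g \<in> bideg (d + d') (e + e')"
  using assms(1)
proof (induction rule: bideg_induct)
  case zero
  show ?case
    using bip.subspace_0[OF subspace_bideg] by simp
next
  case (add c s f)
  have "Poly_Mapping.single s c * g \<in> bideg (d + d') (e + e')"
    using assms(2)
  proof (induction rule: bideg_induct)
    case zero
    show ?case
      using bip.subspace_0[OF subspace_bideg] by simp
  next
    case (add b t g)
    have "Poly_Mapping.single s c * Poly_Mapping.single t b \<in> bideg (d + d') (e + e')"
      using single_in_bideg[of "s + t" "c * b"] add \<open>xdeg s = d\<close> \<open>ydeg s = e\<close>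
      by (simp add: mult_single xdeg_add ydeg_add)
    with add show ?case
      by (simp add: distrib_left bip.subspace_add[OF subspace_bideg])
  qed
  with add show ?case
    by (simp add: distrib_right bip.subspace_add[OF subspace_bideg])
qed

lemma linear_on_diff:
  assumes "linear_on V N" "bip.subspace V" "f \<in> V" "g \<in> V"
  shows "N (f - g) = N f - N g"
proof -
  \<comment> \<open>\<open>linear_on\<close> gives additivity only inside \<open>V\<close>; the
    subspace property puts \<open>f - g\<close> there.\<close>
  have "N f = N ((f - g) + g)"
    by simp
  also have "\<dots> = N (f - g) + N g"
    using assms bip.subspace_diff unfolding linear_on_def by blast
  finally show ?thesis
    by simp
qed

lemma point_eqE:
  assumes "point u v = point u' v'"
  obtains a b where "u = a *s u'" "v = b *s v'"
proof -
  have "u \<in> vec.span {u'}" "v \<in> vec.span {v'}"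
    using assms vec.span_base[of u "{u}"] vec.span_base[of v "{v}"] by (auto simp: point_def)
  then show ?thesis
    using that by (auto simp: vec.span_singleton)
qed

text \<open>Membership in \<open>VX I\<close> only provides some representatives \<open>u'\<close>,
  \<open>v'\<close> at which \<open>I\<close> vanishes. The given \<open>u\<close>, \<open>v\<close>
  are multiples of them, and bihomogeneity of \<open>f\<close> carries the zero over.\<close>

lemma evalp_eq_0_if_point_in_VX:
  assumes "point u v \<in> VX I" "f \<in> I" "f \<in> bideg d e"
  shows "evalp f u v = 0"
proof -
  obtain u' v' where uv: "point u v = point u' v'" "u' \<noteq> 0" "v' \<noteq> 0" "evalp f u' v' = 0"
    using assms by (auto simp: VX_def)
  obtain a b where "u = a *s u'" "v = b *s v'"
    using point_eqE[OF uv(1)] .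
  with uv show ?thesis
    by (simp add: evalp_scale[OF assms(3)])
qed

theorem theorem3p1:
  fixes l m n r d e d' e' :: nat
    and \<alpha> :: "'r::finite \<Rightarrow> complex ^ 'l::finite"
    and \<beta> :: "'r \<Rightarrow> complex ^ 'm::finite"
    and \<gamma> :: "'r \<Rightarrow> complex ^ 'n::finite"
    and A :: "('l, 'm, 'n) tensor"
    and I B :: "('m, 'n) bipoly set"
    and N :: "('m, 'n) bipoly \<Rightarrow> complex ^ 'r"
    and h0 :: "('m, 'n) bipoly"
    and w :: "'r \<Rightarrow> ('m, 'n) bipoly \<Rightarrow> complex"
  assumes "CARD('l) = l + 1" and "CARD('m) = m + 1" and "CARD('n) = n + 1" and "CARD('r) = r"
    and "l \<ge> m" and "m \<ge> n" and "n > 0"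
    and "A = (\<Sum>i\<in>UNIV. tensor_prod (\<alpha> i) (\<beta> i) (\<gamma> i))"
    and "tensor_rank A = r" and "r \<le> min (l + 1) (m * n)"
    and "generic_decomposition \<alpha> \<beta> \<gamma>"
    and "I = flattening_ideal A"
    and "d \<ge> 1" and "e \<ge> 1" and "HF I d e = r"
    and "d' = d - 1" and "e' = e - 1"
    and "h0 \<in> bideg d' e'" and "\<And>i. evalp h0 (\<beta> i) (\<gamma> i) \<noteq> 0"
    and "pre_normal_form I d e N"
    and "bip.subspace B" and "B \<subseteq> bideg 1 1" and "bip.dim B = r"
    and "bij_betw (premult N h0) B UNIV"
    and "\<And>i b. w i b = evalp b (\<beta> i) (\<gamma> i)"
  shows "\<forall>g\<in>bideg d' e'. \<forall>i. \<forall>b\<in>B.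
    w i (mult_map N B g h0 b) =
      evalp g (\<beta> i) (\<gamma> i) / evalp h0 (\<beta> i) (\<gamma> i) * w i b"
proof (intro ballI allI)
  fix g :: "('m, 'n) bipoly" and i b
  assume g: "g \<in> bideg d' e'" and b: "b \<in> B"
  define b' where "b' = mult_map N B g h0 b"
  \<comment> \<open>\<open>inv_into\<close> is a right inverse only on the image of
    \<open>B\<close>, which is everything here by bijectivity onto \<open>UNIV\<close>.\<close>
  have surj: "premult N g b \<in> premult N h0 ` B"
    using assms(24) by (simp add: bij_betw_def)
  then have b': "b' \<in> B" and N_eq: "N (h0 * b') = N (g * b)"
    using inv_into_into[OF surj] f_inv_into_f[OF surj]
    by (simp_all add: b'_def mult_map_def premult_def)
  \<comment> \<open>Subtraction of naturals truncates; \<open>d \<ge> 1\<close> and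
    \<open>e \<ge> 1\<close> ensure \<open>d' + 1 = d\<close> and \<open>e' + 1 = e\<close>.\<close>
  have deg: "q * p \<in> bideg d e" if "q \<in> bideg d' e'" "p \<in> B" for q p
    using bideg_mult[OF that(1), of p 1 1] that(2) assms(13,14,16,17,22) by auto
  have in_deg: "g * b - h0 * b' \<in> bideg d e"
    using bip.subspace_diff[OF subspace_bideg] deg g b b' assms(18) by blast
  have "N (g * b - h0 * b') = 0"
    using linear_on_diff[where N = N, OF _ subspace_bideg deg[OF g b] deg[OF assms(18) b']] assms(20) N_eq
    by (simp add: pre_normal_form_def)
  then have in_I: "g * b - h0 * b' \<in> I"
    using in_deg assms(20) unfolding pre_normal_form_def by blast
  \<comment> \<open>Genericity identifies \<open>VX I\<close> with the set of the points of the
    decomposition.\<close>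
  have "point (\<beta> i) (\<gamma> i) \<in> VX I"
    using assms(8,11,12) by (simp add: generic_decomposition_def Let_def)
  then have "evalp (g * b - h0 * b') (\<beta> i) (\<gamma> i) = 0"
    using evalp_eq_0_if_point_in_VX in_I in_deg by blast
  then have "evalp g (\<beta> i) (\<gamma> i) * w i b = evalp h0 (\<beta> i) (\<gamma> i) * w i b'"
    by (simp add: evalp_diff evalp_mult assms(25))
  then show "w i (mult_map N B g h0 b) =
      evalp g (\<beta> i) (\<gamma> i) / evalp h0 (\<beta> i) (\<gamma> i) * w i b"
    using assms(19)[of i] by (simp add: b'_def field_simps)
qed

end
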